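(* Let $\mathcal{F}$ be a real separable Hilbert space, let $\Phi:\mathcal{F}\to(-\infty,\infty]$ be a generator with $\mathcal{A}=\operatorname{int}(\operatorname{dom}\Phi)$, and let $\mathcal{U}\subset\mathcal{A}$ be a nonempty open convex set. Let $F$ be an $\mathcal{F}$-valued random element such that $\mathbb{P}(F\in\mathcal{U})=1$, $\mathbb{E}\|F\|_{\mathcal{F}}<\infty$, $\mathbb{E}|\Phi(F)|<\infty$, and assume that the Bochner mean $\bar f=\mathbb{E}[F]$ belongs to $\mathcal{U}$. Then $\bar f$ is the unique minimiser of $g\mapsto\mathbb{E}[d_\Phi(F,g)]$ over $\mathcal{U}$, that is, $$\bar f=\arg\min_{g\in\mathcal{U}}\ \mathbb{E}\bigl[d_\Phi(F,g)\bigr].$$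
   Context: A function $\Phi:\mathcal{F}\to(-\infty,\infty]$ on a real Hilbert space $\mathcal{F}$ is called a generator if it is proper, lower semicontinuous, strictly convex, and Fréchet differentiable on $\mathcal{A}=\operatorname{int}(\operatorname{dom}\Phi)\neq\emptyset$. The Fréchet gradient $\nabla\Phi(g)\in\mathcal{F}$ is the Riesz representer of the Fréchet derivative. The functional Bregman divergence generated by $\Phi$ is, for $f,g\in\mathcal{A}$, $d_\Phi(f,g)=\Phi(f)-\Phi(g)-\langle\nabla\Phi(g),f-g\rangle_{\mathcal{F}}$. A random element of $\mathcal{F}$ is a measurable map from a probability space into $\mathcal{F}$ with its Borel $\sigma$-algebra; its Bochner mean is its Bochner integral with respect to $\mathbb{P}$. *)

theory Defs
  imports "HOL-Probability.Probability"
begin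

definition eff_dom :: "('a \<Rightarrow> ereal) \<Rightarrow> 'a set" where
  "eff_dom \<Phi> = {x. \<Phi> x < \<infinity>}"

definition proper_fun :: "('a \<Rightarrow> ereal) \<Rightarrow> bool" where
  "proper_fun \<Phi> \<longleftrightarrow> (\<forall>x. \<Phi> x \<noteq> -\<infinity>) \<and> eff_dom \<Phi> \<noteq> {}"

definition lower_semicont :: "('a::topological_space \<Rightarrow> ereal) \<Rightarrow> bool" where
  "lower_semicont \<Phi> \<longleftrightarrow> (\<forall>x. \<Phi> x \<le> Liminf (at x) \<Phi>)"

definition strictly_convex :: "('a::real_vector \<Rightarrow> ereal) \<Rightarrow> bool" where
  "strictly_convex \<Phi> \<longleftrightarrow>
     (\<forall>x \<in> eff_dom \<Phi>. \<forall>y \<in> eff_dom \<Phi>. \<forall>t. x \<noteq> y \<longrightarrow> 0 < t \<longrightarrow> t < 1 \<longrightarrow>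
        \<Phi> ((1 - t) *\<^sub>R x + t *\<^sub>R y) < ereal (1 - t) * \<Phi> x + ereal t * \<Phi> y)"

(* On the interior of the effective domain a proper function is real-valued, so there it agrees
   locally with its real-valued version, whose derivative is therefore the intended one. *)
definition generator :: "('a::real_inner \<Rightarrow> ereal) \<Rightarrow> bool" where
  "generator \<Phi> \<longleftrightarrow>
     proper_fun \<Phi> \<and> lower_semicont \<Phi> \<and> strictly_convex \<Phi> \<and>
     interior (eff_dom \<Phi>) \<noteq> {} \<and>
     (\<forall>g \<in> interior (eff_dom \<Phi>). (\<lambda>x. real_of_ereal (\<Phi> x)) differentiable (at g))"

(* GDERIV f g :> v says that f has Frechet derivative h \<mapsto> h \<bullet> v at g, that is, v is the Riesz
   representer of the derivative. *)
definition frechet_gradient :: "('a::real_inner \<Rightarrow> ereal) \<Rightarrow> 'a \<Rightarrow> 'a" where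
  "frechet_gradient \<Phi> g = (THE v. GDERIV (\<lambda>x. real_of_ereal (\<Phi> x)) g :> v)"

(* Meaningful for f and g in the interior of the effective domain of the generator. *)
definition bregman_div :: "('a::real_inner \<Rightarrow> ereal) \<Rightarrow> 'a \<Rightarrow> 'a \<Rightarrow> real" where
  "bregman_div \<Phi> f g =
     real_of_ereal (\<Phi> f) - real_of_ereal (\<Phi> g) - inner (frechet_gradient \<Phi> g) (f - g)"

end

theory Submission
  imports Defs
begin

text \<open>For fixed \<open>g\<close>, the divergence \<open>d(F, g)\<close> is \<open>\<Phi>(F)\<close> plus an affine function of \<open>F\<close>, so with
  \<open>m = E F\<close> its expectation exceeds that of \<open>d(F, m)\<close> by exactly \<open>d(m, g)\<close>, which strict convexity
  makes positive unless \<open>g = m\<close>. Lower semicontinuity gives the measurability of \<open>\<Phi>(F)\<close>, and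
  completeness the existence of the gradient, by the Riesz representation theorem.\<close>

text \<open>Strict superlevel sets are open, and they generate the Borel sets of the extended
  reals.\<close>

lemma lower_semicont_borel_measurable:
  fixes \<Phi> :: "'a::topological_space \<Rightarrow> ereal"
  assumes "lower_semicont \<Phi>"
  shows "\<Phi> \<in> borel_measurable borel"
proof (rule borel_measurableI_greater)
  fix a
  have "open {x. a < \<Phi> x}"
  proof (subst open_subopen, safe)
    fix x assume a: "a < \<Phi> x"
    then have "a < Liminf (at x) \<Phi>"
      using assms unfolding lower_semicont_def by (meson less_le_trans)
    then have "eventually (\<lambda>y. a < \<Phi> y) (at x)"
      by (rule less_LiminfD)
    \<comment> \<open>\<open>Liminf (at x)\<close> ignores the point \<open>x\<close>, so the
      punctured neighbourhood is completed by the assumption at \<open>x\<close> itself.\<close>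
    with a have "eventually (\<lambda>y. a < \<Phi> y) (nhds x)"
      unfolding eventually_at_filter by (auto elim: eventually_mono)
    then show "\<exists>T. open T \<and> x \<in> T \<and> T \<subseteq> {x. a < \<Phi> x}"
      unfolding eventually_nhds by blast
  qed
  then show "{x \<in> space borel. a < \<Phi> x} \<in> sets borel"
    by simp
qed

text \<open>The quadratic attains its minimum 0 at \<open>t = 0\<close>, so its derivative
  \<open>2 * b\<close> vanishes there. This supplies the first-order condition for the minimiser in
  the Riesz theorem.\<close>

lemma quadratic_nonneg_imp_linear_zero:
  fixes a b :: real
  assumes "\<And>t. 0 \<le> 2 * t * b + t\<^sup>2 * a"
  shows "b = 0"
proof -
  have "((\<lambda>t. 2 * t * b + t\<^sup>2 * a) has_real_derivative 2 * b) (at 0)"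
    by (auto intro!: derivative_eq_intros)
  then have "2 * b = 0"
    by (rule DERIV_local_min[where d = 1]) (use assms in auto)
  then show ?thesis by simp
qed

text \<open>The representer is the minimiser of \<open>x \<mapsto> \<parallel>x\<parallel>\<^sup>2 - 2 L x\<close>, whose minimising sequences are
  Cauchy by the parallelogram law.\<close>

lemma riesz_representation:
  fixes L :: "'a::{real_inner, banach} \<Rightarrow> real"
  assumes "bounded_linear L"
  shows "\<exists>v. \<forall>h. L h = inner h v"
proof -
  interpret L: bounded_linear L by fact
  define J where "J x = (norm x)\<^sup>2 - 2 * L x" for x
  obtain K where K: "\<And>x. norm (L x) \<le> norm x * K"
    using L.bounded by blast
  \<comment> \<open>Completing the square: \<open>J x\<close> is at least (|x| - K)^2 - K^2.\<close>
  have "- K\<^sup>2 \<le> J x" for x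
  proof -
    have "0 \<le> (norm x - K)\<^sup>2" by simp
    then show ?thesis
      using K[of x] unfolding J_def power2_diff by (simp add: algebra_simps)
  qed
  then have bdd: "bdd_below (range J)" by (intro bdd_belowI[of _ "- K\<^sup>2"]) auto
  define I where "I = (INF x. J x)"
  have I_le: "I \<le> J x" for x
    unfolding I_def using bdd by (simp add: cINF_lower)
  have "\<exists>x. J x < I + 1 / real (Suc n)" for n
    using cINF_less_iff[OF _ bdd, of "I + 1 / real (Suc n)"] unfolding I_def by force
  then obtain X where X: "\<And>n. J (X n) < I + 1 / real (Suc n)" by metis
  \<comment> \<open>In the parallelogram law at the midpoint the linear parts of \<open>J\<close>
    cancel, and the midpoint value of \<open>J\<close> is at least \<open>I\<close>.\<close>
  have par: "(dist x y)\<^sup>2 \<le> 2 * (J x - I) + 2 * (J y - I)" for x y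
  proof -
    have "2 * J x + 2 * J y - 4 * J ((1/2) *\<^sub>R (x + y)) = (dist x y)\<^sup>2"
      unfolding J_def dist_norm power2_norm_eq_inner
      by (simp add: L.add L.scaleR inner_commute algebra_simps)
    then show ?thesis using I_le[of "(1/2) *\<^sub>R (x + y)"] by simp
  qed
  have "Cauchy X"
  proof (rule metric_CauchyI)
    fix e :: real assume "0 < e"
    \<comment> \<open>In \<open>par\<close> the two excesses over \<open>I\<close> enter with factor
      2 each, so a bound of a quarter of e^2 on both gives e^2.\<close>
    then obtain N where N: "inverse (real (Suc N)) < e\<^sup>2 / 4"
      using reals_Archimedean[of "e\<^sup>2 / 4"] by auto
    have small: "J (X n) - I < e\<^sup>2 / 4" if "n \<ge> N" for n
    proof -
      have "1 / real (Suc n) \<le> inverse (real (Suc N))"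
        using that by (simp add: field_simps)
      then show ?thesis using X[of n] N by linarith
    qed
    have "dist (X m) (X n) < e" if "m \<ge> N" "n \<ge> N" for m n
    proof -
      have "(dist (X m) (X n))\<^sup>2 < e\<^sup>2"
        using par[of "X m" "X n"] small[OF that(1)] small[OF that(2)] by (simp add: field_simps)
      then show ?thesis using \<open>0 < e\<close> by (simp add: power2_less_imp_less)
    qed
    then show "\<exists>N. \<forall>m\<ge>N. \<forall>n\<ge>N. dist (X m) (X n) < e" by blast
  qed
  then obtain v where v: "X \<longlonglongrightarrow> v"
    using Cauchy_convergent convergent_def by blast
  have "(\<lambda>n. J (X n)) \<longlonglongrightarrow> J v"
    unfolding J_def by (intro tendsto_intros L.tendsto v)
  moreover have "(\<lambda>n. I + 1 / real (Suc n)) \<longlonglongrightarrow> I + 0"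
    using LIMSEQ_inverse_real_of_nat by (intro tendsto_intros) (simp add: field_simps)
  ultimately have "J v \<le> I + 0"
    by (rule LIMSEQ_le) (use X less_imp_le in blast)
  have "L h = inner h v" for h
  proof -
    \<comment> \<open>The right-hand side is the increment of \<open>J\<close> from its minimiser
      \<open>v\<close> to \<open>v + t *\<^sub>R h\<close>.\<close>
    have "0 \<le> 2 * t * (inner h v - L h) + t\<^sup>2 * (norm h)\<^sup>2" for t
    proof -
      have "J (v + t *\<^sub>R h) - J v = 2 * t * (inner h v - L h) + t\<^sup>2 * (norm h)\<^sup>2"
        unfolding J_def power2_norm_eq_inner
        by (simp add: L.add L.scaleR inner_commute algebra_simps power2_eq_square)
      then show ?thesis using I_le[of "v + t *\<^sub>R h"] \<open>J v \<le> I + 0\<close> by linarith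
    qed
    from quadratic_nonneg_imp_linear_zero[OF this] show ?thesis by simp
  qed
  then show ?thesis by blast
qed

text \<open>The definite description is well defined: Riesz gives a representer, and two
  representers of the same derivative agree when tested on their difference.\<close>

lemma GDERIV_frechet_gradient:
  fixes \<Phi> :: "'a::{real_inner, banach} \<Rightarrow> ereal"
  assumes "(\<lambda>x. real_of_ereal (\<Phi> x)) differentiable (at g)"
  shows "GDERIV (\<lambda>x. real_of_ereal (\<Phi> x)) g :> frechet_gradient \<Phi> g"
proof -
  obtain L where L: "((\<lambda>x. real_of_ereal (\<Phi> x)) has_derivative L) (at g)"
    using assms unfolding differentiable_def by blast
  obtain v where "\<And>h. L h = inner h v"
    using riesz_representation[OF has_derivative_bounded_linear[OF L]] by blast
  then have v: "GDERIV (\<lambda>x. real_of_ereal (\<Phi> x)) g :> v"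
    using L unfolding gderiv_def by (metis ext)
  have "w = v" if "GDERIV (\<lambda>x. real_of_ereal (\<Phi> x)) g :> w" for w
  proof -
    have "(\<lambda>h. inner h w) = (\<lambda>h. inner h v)"
      using that v unfolding gderiv_def by (rule has_derivative_unique)
    then have "inner (w - v) (w - v) = 0"
      by (metis inner_diff_right diff_self)
    then show ?thesis by simp
  qed
  with v show ?thesis
    unfolding frechet_gradient_def by (rule theI)
qed

text \<open>Properness makes both endpoint values real, so the bound in the extended reals is
  finite; this also puts the convex combination into the domain.\<close>

lemma strictly_convex_real:
  fixes \<Phi> :: "'a::real_vector \<Rightarrow> ereal"
  assumes "proper_fun \<Phi>" "strictly_convex \<Phi>"
    and "x \<in> eff_dom \<Phi>" "y \<in> eff_dom \<Phi>" "x \<noteq> y" "0 < t" "t < 1"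
  shows "(1 - t) *\<^sub>R x + t *\<^sub>R y \<in> eff_dom \<Phi>"
    and "real_of_ereal (\<Phi> ((1 - t) *\<^sub>R x + t *\<^sub>R y))
           < (1 - t) * real_of_ereal (\<Phi> x) + t * real_of_ereal (\<Phi> y)"
proof -
  let ?z = "(1 - t) *\<^sub>R x + t *\<^sub>R y"
  have real: "\<Phi> w = ereal (real_of_ereal (\<Phi> w))" if "w \<in> eff_dom \<Phi>" for w
    using that assms(1) unfolding eff_dom_def proper_fun_def by (cases "\<Phi> w") auto
  have lt: "\<Phi> ?z < ereal ((1 - t) * real_of_ereal (\<Phi> x) + t * real_of_ereal (\<Phi> y))"
  proof -
    have "\<Phi> ?z < ereal (1 - t) * \<Phi> x + ereal t * \<Phi> y"
      using assms(2-) unfolding strictly_convex_def by blast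
    then show ?thesis
      by (subst (asm) (1 2) real) (simp_all add: assms)
  qed
  then show z: "?z \<in> eff_dom \<Phi>"
    unfolding eff_dom_def using order_less_trans by fastforce
  show "real_of_ereal (\<Phi> ?z) < (1 - t) * real_of_ereal (\<Phi> x) + t * real_of_ereal (\<Phi> y)"
    using lt by (subst (asm) real[OF z]) simp
qed

lemma bregman_div_self [simp]: "bregman_div \<Phi> f f = 0"
  by (simp add: bregman_div_def)

text \<open>On the segment from \<open>g\<close> to \<open>f\<close>, convexity bounds the
  difference quotients at \<open>g\<close> by \<Phi>(f) - \<Phi>(g), and they tend to the
  directional derivative.\<close>

lemma bregman_div_nonneg:
  fixes \<Phi> :: "'a::{real_inner, banach} \<Rightarrow> ereal"
  assumes "generator \<Phi>" "f \<in> eff_dom \<Phi>" "g \<in> interior (eff_dom \<Phi>)"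
  shows "0 \<le> bregman_div \<Phi> f g"
proof (cases "f = g")
  case False
  let ?\<phi> = "\<lambda>x. real_of_ereal (\<Phi> x)"
  let ?c = "\<lambda>t. (1 - t) *\<^sub>R g + t *\<^sub>R f"
  have gen: "proper_fun \<Phi>" "strictly_convex \<Phi>" "?\<phi> differentiable (at g)"
    using assms unfolding generator_def by auto
  have g: "g \<in> eff_dom \<Phi>" using assms(3) interior_subset by blast
  have c: "(?c has_derivative (\<lambda>t. t *\<^sub>R (f - g))) (at 0)"
    by (auto intro!: derivative_eq_intros simp: algebra_simps)
  have "(?\<phi> has_derivative (\<lambda>h. inner h (frechet_gradient \<Phi> g))) (at (?c 0))"
    using GDERIV_frechet_gradient[OF gen(3)] unfolding gderiv_def by simp
  from has_derivative_compose[OF c this]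
  have "((\<lambda>t. ?\<phi> (?c t)) has_real_derivative inner (f - g) (frechet_gradient \<Phi> g)) (at 0)"
    unfolding has_field_derivative_def by (simp add: mult_commute_abs)
  \<comment> \<open>Only the right-hand limit is kept, since the segment from \<open>g\<close> to
    \<open>f\<close> corresponds to positive \<open>t\<close>.\<close>
  then have lim: "((\<lambda>t. (?\<phi> (?c t) - ?\<phi> g) / t) \<longlongrightarrow> inner (f - g) (frechet_gradient \<Phi> g)) (at_right 0)"
    unfolding DERIV_def
    by (auto simp: field_simps intro: filterlim_mono at_le)
  have "(?\<phi> (?c t) - ?\<phi> g) / t \<le> ?\<phi> f - ?\<phi> g" if "0 < t" "t < 1" for t
    using strictly_convex_real(2)[OF gen(1,2) g assms(2) _ that] False that
    by (simp add: field_simps)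
  then have "\<forall>\<^sub>F t in at_right 0. (?\<phi> (?c t) - ?\<phi> g) / t \<le> ?\<phi> f - ?\<phi> g"
    unfolding eventually_at_right_field by (intro exI[of _ 1]) auto
  from tendsto_upperbound[OF lim this] show ?thesis
    unfolding bregman_div_def by (simp add: inner_commute)
qed simp

text \<open>At the midpoint \<open>m\<close> of \<open>g\<close> and \<open>f\<close> the gradient
  term is halved, so strict convexity gives 0 <= d(m, g) < d(f, g) / 2.\<close>

lemma bregman_div_pos:
  fixes \<Phi> :: "'a::{real_inner, banach} \<Rightarrow> ereal"
  assumes "generator \<Phi>" "f \<in> eff_dom \<Phi>" "g \<in> interior (eff_dom \<Phi>)" "f \<noteq> g"
  shows "0 < bregman_div \<Phi> f g"
proof -
  have gen: "proper_fun \<Phi>" "strictly_convex \<Phi>"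
    using assms unfolding generator_def by auto
  have g: "g \<in> eff_dom \<Phi>" using assms(3) interior_subset by blast
  define m where "m = (1 - 1/2) *\<^sub>R g + (1/2::real) *\<^sub>R f"
  have m: "m \<in> eff_dom \<Phi>"
    "real_of_ereal (\<Phi> m) < (real_of_ereal (\<Phi> g) + real_of_ereal (\<Phi> f)) / 2"
    using strictly_convex_real[OF gen g assms(2), of "1/2"] assms(4) by (auto simp: m_def)
  have "m - g = (1/2) *\<^sub>R (f - g)"
    unfolding m_def by (simp add: algebra_simps flip: scaleR_add_left)
  then show ?thesis
    using bregman_div_nonneg[OF assms(1) m(1) assms(3)] m(2) unfolding bregman_div_def
    by simp
qed

theorem theorem10:
  fixes \<Phi> :: "'a::{real_inner, banach, second_countable_topology} \<Rightarrow> ereal"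
    and \<U> :: "'a set"
    and M :: "'w measure"
    and F :: "'w \<Rightarrow> 'a"
  assumes "generator \<Phi>"
    and "\<U> \<subseteq> interior (eff_dom \<Phi>)" and "\<U> \<noteq> {}" and "open \<U>" and "convex \<U>"
    and "prob_space M" and "F \<in> borel_measurable M"
    and "measure M {\<omega> \<in> space M. F \<omega> \<in> \<U>} = 1"
    and "(\<integral>\<^sup>+\<omega>. ennreal (norm (F \<omega>)) \<partial>M) < \<infinity>"
    and "(\<integral>\<^sup>+\<omega>. e2ennreal \<bar>\<Phi> (F \<omega>)\<bar> \<partial>M) < \<infinity>"
    and "(\<integral>\<omega>. F \<omega> \<partial>M) \<in> \<U>"
  shows "(\<forall>g \<in> \<U>. integrable M (\<lambda>\<omega>. bregman_div \<Phi> (F \<omega>) g)) \<and>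
         {g. is_arg_min (\<lambda>g. \<integral>\<omega>. bregman_div \<Phi> (F \<omega>) g \<partial>M) (\<lambda>g. g \<in> \<U>) g} = {\<integral>\<omega>. F \<omega> \<partial>M}"
proof -
  interpret prob_space M by fact
  define m where "m = (\<integral>\<omega>. F \<omega> \<partial>M)"
  have "lower_semicont \<Phi>" using assms(1) unfolding generator_def by blast
  note [measurable] = lower_semicont_borel_measurable[OF this] assms(7)
  have F [simp]: "integrable M F"
    using assms(9) by (intro integrableI_bounded) auto
  have \<Phi>F [simp]: "integrable M (\<lambda>\<omega>. real_of_ereal (\<Phi> (F \<omega>)))"
  proof (rule integrableI_bounded)
    \<comment> \<open>Since \<open>real_of_ereal\<close> sends both infinities to 0, the bound
      covers infinite values as well.\<close>
    have "ennreal (norm (real_of_ereal y)) \<le> e2ennreal \<bar>y\<bar>" for y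
      by (cases y) (simp_all add: e2ennreal_ereal)
    then have "(\<integral>\<^sup>+\<omega>. ennreal (norm (real_of_ereal (\<Phi> (F \<omega>)))) \<partial>M)
        \<le> (\<integral>\<^sup>+\<omega>. e2ennreal \<bar>\<Phi> (F \<omega>)\<bar> \<partial>M)"
      by (intro nn_integral_mono)
    then show "(\<integral>\<^sup>+\<omega>. ennreal (norm (real_of_ereal (\<Phi> (F \<omega>)))) \<partial>M) < \<infinity>"
      using assms(10) by (rule le_less_trans)
  qed measurable
  have int: "integrable M (\<lambda>\<omega>. bregman_div \<Phi> (F \<omega>) g)" for g
    unfolding bregman_div_def by simp
  have expect: "(\<integral>\<omega>. bregman_div \<Phi> (F \<omega>) g \<partial>M)
      = (\<integral>\<omega>. real_of_ereal (\<Phi> (F \<omega>)) \<partial>M) - real_of_ereal (\<Phi> g)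
        - inner (frechet_gradient \<Phi> g) (m - g)" for g
    unfolding bregman_div_def m_def by (simp add: prob_space)
  \<comment> \<open>For \<open>g = m\<close> the gradient term in \<open>expect\<close> vanishes,
    leaving E \<Phi>(F) - \<Phi>(m); the difference of the two expectations is then d(m, g).\<close>
  have split: "(\<integral>\<omega>. bregman_div \<Phi> (F \<omega>) g \<partial>M)
      = (\<integral>\<omega>. bregman_div \<Phi> (F \<omega>) m \<partial>M) + bregman_div \<Phi> m g" for g
    unfolding expect[of g] expect[of m] by (simp add: bregman_div_def)
  have m: "m \<in> \<U>" "m \<in> eff_dom \<Phi>"
    using assms(2,11) interior_subset unfolding m_def by blast+
  have pos: "0 < bregman_div \<Phi> m g" if "g \<in> \<U>" "g \<noteq> m" for g
    using bregman_div_pos[OF assms(1) m(2)] that assms(2) by blast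
  have "is_arg_min (\<lambda>g. \<integral>\<omega>. bregman_div \<Phi> (F \<omega>) g \<partial>M) (\<lambda>g. g \<in> \<U>) g \<longleftrightarrow> g = m" for g
  proof
    assume min: "is_arg_min (\<lambda>g. \<integral>\<omega>. bregman_div \<Phi> (F \<omega>) g \<partial>M) (\<lambda>g. g \<in> \<U>) g"
    \<comment> \<open>Comparing \<open>g\<close> with the competitor \<open>m\<close> in
      \<open>split\<close> forces the excess to be nonpositive.\<close>
    then have "bregman_div \<Phi> m g \<le> 0"
      using m(1) split[of g] unfolding is_arg_min_linorder by fastforce
    moreover have "g \<in> \<U>"
      using min unfolding is_arg_min_def by blast
    ultimately show "g = m"
      using pos[of g] by linarith
  next
    assume "g = m"
    moreover have "(\<integral>\<omega>. bregman_div \<Phi> (F \<omega>) m \<partial>M) \<le> (\<integral>\<omega>. bregman_div \<Phi> (F \<omega>) h \<partial>M)"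
      if "h \<in> \<U>" for h
      using pos[OF that] split[of h] by (cases "h = m") simp_all
    ultimately show "is_arg_min (\<lambda>g. \<integral>\<omega>. bregman_div \<Phi> (F \<omega>) g \<partial>M) (\<lambda>g. g \<in> \<U>) g"
      using m(1) unfolding is_arg_min_linorder by blast
  qed
  then show ?thesis
    using int unfolding m_def by auto
qed

end
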